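(* Consider a run of the IBCN method (described in the context) on a function $f:\mathbb R^n\to\mathbb R$ whose Hessian is Lipschitz continuous with constant $L>0$, and suppose the method generates an infinite sequence $\{x_k\}$. If there exist finite constants $f^{\min}$ and $B$ such that $f(x)\ge f^{\min}$ and $\|\nabla^2 f(x)\|\le B$ for all $x$ in the level set $\mathcal L^0=\{x\in\mathbb R^n: f(x)\le f(x_0)\}$, then $$\lim_{k\to\infty}\nabla f(x_k)=0.$$
   Context: Setting and notation. $f:\mathbb R^n\to\mathbb R$ is a (possibly non-convex) twice differentiable function with $\|\nabla^2 f(x)-\nabla^2 f(y)\|\le L\|x-y\|$ for all $x,y\in\mathbb R^n$, where $L>0$. $\|\cdot\|$ is the Euclidean norm for vectors and the induced operator norm for matrices. For $\mathcal I\subseteq\{1,\dots,n\}$, $U_{\mathcal I}\in\mathbb R^{n\times|\mathcal I|}$ is the submatrix of the $n\times n$ identity obtained by keeping the columns with indices in $\mathcal I$; $\nabla_{\mathcal I}f(x)=U_{\mathcal I}^T\nabla f(x)$ and $\nabla^2_{\mathcal I}f(x)=U_{\mathcal I}^T\nabla^2 f(x)U_{\mathcal I}$. IBCN method. Parameters: $x_0\in\mathbb R^n$, $\sigma^{\min}>0$, $\sigma_0\in[\sigma^{\min},\infty)$, $0<\eta_1\le\eta_2<1$, $0<\gamma_1\le1<\gamma_2\le\gamma_3$, $\tau\in[0,\infty)$, $\beta\in(0,1)$, $\theta\in(0,1]$. For $k=0,1,2,\dots$: if $\nabla f(x_k)=0$, stop; otherwise perform iteration $k$: (1) choose any block $\mathcal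 I_k\subseteq\{1,\dots,n\}$ with $\|\nabla_{\mathcal I_k}f(x_k)\|\ge\theta\|\nabla f(x_k)\|$; (2) define, for $s\in\mathbb R^{|\mathcal I_k|}$, $q_k(s)=f(x_k)+\nabla_{\mathcal I_k}f(x_k)^Ts+\frac12 s^T\nabla^2_{\mathcal I_k}f(x_k)s$ and $m_k(s)=q_k(s)+\frac{\sigma_k}{6}\|s\|^3$, and choose any $s_k\in\mathbb R^{|\mathcal I_k|}$ with $\|\nabla m_k(s_k)\|\le\tau\|s_k\|^2$ and $m_k(s_k)\le m_k(\hat s_k)$, where $\hat s_k=-\hat\alpha_k\nabla_{\mathcal I_k}f(x_k)$ and $\hat\alpha_k=\min\Bigl\{\frac{\beta}{\|\nabla^2_{\mathcal I_k}f(x_k)\|},\sqrt{\frac{3\beta}{\sigma_k\|\nabla_{\mathcal I_k}f(x_k)\|}}\Bigr\}$ (the first argument of the min is $+\infty$ when $\|\nabla^2_{\mathcal I_k}f(x_k)\|=0$); (3) compute $\rho_k=\frac{f(x_k)-f(x_k+U_{\mathcal I_k}s_k)}{q_k(0)-q_k(s_k)}$; (4) set $x_{k+1}=x_k+U_{\mathcal I_k}s_k$ if $\rho_k\ge\eta_1$, and $x_{k+1}=x_k$ otherwise; (5) choose any $\sigma_{k+1}\in[\max\{\sigma^{\min},\gamma_1\sigma_k\},\sigma_k]$ if $\rho_k\ge\eta_2$; any $\sigma_{k+1}\in[\sigma_k,\gamma_2\sigma_k]$ if $\rho_k\in[\eta_1,\eta_2)$; any $\sigma_{k+1}\in[\gamma_2\sigma_k,\gamma_3\sigma_k]$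 if $\rho_k<\eta_1$. *)

theory Defs
  imports "HOL-Analysis.Analysis"
begin

definition gradient :: "('a::real_inner \<Rightarrow> real) \<Rightarrow> 'a \<Rightarrow> 'a" where
  "gradient f x = (THE D. GDERIV f x :> D)"

definition hessian :: "(real^'n \<Rightarrow> real) \<Rightarrow> real^'n \<Rightarrow> real^'n^'n" where
  "hessian f x = matrix (frechet_derivative (gradient f) (at x))"

definition twice_differentiable :: "(real^'n \<Rightarrow> real) \<Rightarrow> bool" where
  "twice_differentiable f \<longleftrightarrow>
     (\<forall>x. f differentiable (at x)) \<and> (\<forall>x. gradient f differentiable (at x))"

abbreviation opnorm :: "real^'n^'m \<Rightarrow> real" where
  "opnorm A \<equiv> onorm (\<lambda>v. A *v v)"

definition lipschitz_hessian :: "real \<Rightarrow> (real^'n \<Rightarrow> real) \<Rightarrow> bool" where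
  "lipschitz_hessian L f \<longleftrightarrow>
     (\<forall>x y. opnorm (hessian f x - hessian f y) \<le> L * norm (x - y))"

text \<open>
  A block is a set \<open>I\<close> of coordinates, and its size varies along a run, so \<open>\<real>\<^sup>|\<^sup>I\<^sup>|\<close> cannot
  be a type of the form \<open>real^'m\<close>.  It is represented by the coordinate subspace of vectors
  of \<open>real^'n\<close> supported on \<open>I\<close>; the embedding is a linear isometry.  Accordingly
  \<open>block_embed I\<close> is the identity matrix with the columns outside \<open>I\<close> set to zero instead of
  deleted, and block gradients and block Hessians are padded with zeros, which changes neither
  Euclidean nor operator norms.
\<close>

definition block_space :: "'n set \<Rightarrow> (real^'n) set" where
  "block_space I = {s. \<forall>i. i \<notin> I \<longrightarrow> s $ i = 0}"

definition block_embed :: "'n set \<Rightarrow> real^'n^'n" where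
  "block_embed I = (\<chi> i j. if i = j \<and> j \<in> I then 1 else 0)"

definition block_gradient :: "'n set \<Rightarrow> (real^'n \<Rightarrow> real) \<Rightarrow> real^'n \<Rightarrow> real^'n" where
  "block_gradient I f x = transpose (block_embed I) *v gradient f x"

definition block_hessian :: "'n set \<Rightarrow> (real^'n \<Rightarrow> real) \<Rightarrow> real^'n \<Rightarrow> real^'n^'n" where
  "block_hessian I f x = transpose (block_embed I) ** hessian f x ** block_embed I"

definition quad_model :: "'n set \<Rightarrow> (real^'n \<Rightarrow> real) \<Rightarrow> real^'n \<Rightarrow> real^'n \<Rightarrow> real" where
  "quad_model I f x s =
     f x + block_gradient I f x \<bullet> s + (1/2) * (s \<bullet> (block_hessian I f x *v s))"

text \<open>
  As a function on all of \<open>real^'n\<close>, the cubic model depends on the components of \<open>s\<close> outside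
  \<open>I\<close> only through \<open>norm s\<close>.  Hence at points of \<open>block_space I\<close> its gradient
  again lies in \<open>block_space I\<close> and is the zero-padded gradient of the model on \<open>\<real>\<^sup>|\<^sup>I\<^sup>|\<close>.
\<close>

definition cubic_model ::
    "'n set \<Rightarrow> (real^'n \<Rightarrow> real) \<Rightarrow> real^'n \<Rightarrow> real \<Rightarrow> real^'n \<Rightarrow> real" where
  "cubic_model I f x \<sigma> s = quad_model I f x s + \<sigma> / 6 * norm s ^ 3"

definition cauchy_stepsize ::
    "real \<Rightarrow> 'n set \<Rightarrow> (real^'n \<Rightarrow> real) \<Rightarrow> real^'n \<Rightarrow> real \<Rightarrow> real" where
  "cauchy_stepsize \<beta> I f x \<sigma> =
     (let r = sqrt (3 * \<beta> / (\<sigma> * norm (block_gradient I f x)));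
          h = opnorm (block_hessian I f x)
      in if h = 0 then r else min (\<beta> / h) r)"

definition cauchy_step ::
    "real \<Rightarrow> 'n set \<Rightarrow> (real^'n \<Rightarrow> real) \<Rightarrow> real^'n \<Rightarrow> real \<Rightarrow> real^'n" where
  "cauchy_step \<beta> I f x \<sigma> = - (cauchy_stepsize \<beta> I f x \<sigma> *\<^sub>R block_gradient I f x)"

definition decrease_ratio ::
    "'n set \<Rightarrow> (real^'n \<Rightarrow> real) \<Rightarrow> real^'n \<Rightarrow> real^'n \<Rightarrow> real" where
  "decrease_ratio I f x s =
     (f x - f (x + block_embed I *v s)) / (quad_model I f x 0 - quad_model I f x s)"

record ibcn_parameters =
  sigma_min :: real
  eta1 :: real
  eta2 :: real
  gamma1 :: real
  gamma2 :: real
  gamma3 :: real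
  tau :: real
  beta :: real
  theta :: real

definition valid_parameters :: "ibcn_parameters \<Rightarrow> bool" where
  "valid_parameters p \<longleftrightarrow>
     0 < sigma_min p \<and>
     0 < eta1 p \<and> eta1 p \<le> eta2 p \<and> eta2 p < 1 \<and>
     0 < gamma1 p \<and> gamma1 p \<le> 1 \<and> 1 < gamma2 p \<and> gamma2 p \<le> gamma3 p \<and>
     0 \<le> tau p \<and>
     0 < beta p \<and> beta p < 1 \<and>
     0 < theta p \<and> theta p \<le> 1"

definition block_choice ::
    "ibcn_parameters \<Rightarrow> (real^'n \<Rightarrow> real) \<Rightarrow> real^'n \<Rightarrow> 'n set \<Rightarrow> bool" where
  "block_choice p f x I \<longleftrightarrow> norm (block_gradient I f x) \<ge> theta p * norm (gradient f x)"

definition step_choice ::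
    "ibcn_parameters \<Rightarrow> (real^'n \<Rightarrow> real) \<Rightarrow> real^'n \<Rightarrow> real \<Rightarrow> 'n set \<Rightarrow> real^'n \<Rightarrow> bool" where
  "step_choice p f x \<sigma> I s \<longleftrightarrow>
     s \<in> block_space I \<and>
     norm (gradient (cubic_model I f x \<sigma>) s) \<le> tau p * (norm s)\<^sup>2 \<and>
     cubic_model I f x \<sigma> s \<le> cubic_model I f x \<sigma> (cauchy_step (beta p) I f x \<sigma>)"

definition sigma_update :: "ibcn_parameters \<Rightarrow> real \<Rightarrow> real \<Rightarrow> real set" where
  "sigma_update p \<rho> \<sigma> =
     (if \<rho> \<ge> eta2 p then {max (sigma_min p) (gamma1 p * \<sigma>) .. \<sigma>}
      else if \<rho> \<ge> eta1 p then {\<sigma> .. gamma2 p * \<sigma>}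
      else {gamma2 p * \<sigma> .. gamma3 p * \<sigma>})"

text \<open>
  An infinite run: the stopping test fails at every iterate.
\<close>

definition infinite_ibcn_run ::
    "ibcn_parameters \<Rightarrow> (real^'n \<Rightarrow> real) \<Rightarrow> (nat \<Rightarrow> real^'n) \<Rightarrow> (nat \<Rightarrow> real) \<Rightarrow>
     (nat \<Rightarrow> 'n set) \<Rightarrow> (nat \<Rightarrow> real^'n) \<Rightarrow> bool" where
  "infinite_ibcn_run p f x \<sigma> I s \<longleftrightarrow>
     \<sigma> 0 \<ge> sigma_min p \<and>
     (\<forall>k. gradient f (x k) \<noteq> 0 \<and>
          block_choice p f (x k) (I k) \<and>
          step_choice p f (x k) (\<sigma> k) (I k) (s k) \<and>
          (let \<rho> = decrease_ratio (I k) f (x k) (s k) in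
             x (Suc k) = (if \<rho> \<ge> eta1 p then x k + block_embed (I k) *v s k else x k) \<and>
             \<sigma> (Suc k) \<in> sigma_update p \<rho> (\<sigma> k)))"

end

theory Submission
  imports Defs
begin

text \<open>
  Every successful iteration with a large gradient lowers \<open>f\<close> by a fixed amount, which can happen
  only finitely often when \<open>f\<close> is bounded below on the level set.  Two facts make this work.

  The first is a model decrease.  The accepted step does at least as well in the cubic model as the
  Cauchy step, whose length is chosen so that the curvature term and the cubic term together undo at
  most a fraction \<open>\<beta>\<close> of the first-order decrease.  So, with \<open>g\<close> the block gradient and \<open>\<alpha>\<close> the
  Cauchy step size, the quadratic model decreases by at least
  \<open>(1 - \<beta>) \<alpha> \<parallel>g\<parallel>\<^sup>2 + \<sigma>/6 \<parallel>s\<parallel>\<^sup>3\<close> (\<open>quad_model_decrease\<close>).  An upper bound on \<open>\<sigma>\<close> and on the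
  Hessian keeps \<open>\<alpha> \<parallel>g\<parallel>\<^sup>2\<close> away from zero as long as \<open>\<parallel>g\<parallel>\<close> is
  (\<open>run_cauchy_decrease_lower_bound\<close>).

  The second is that \<open>\<sigma>\<close> stays bounded (\<open>run_sigma_bounded\<close>).  By the Lipschitz condition on the
  Hessian, \<open>f\<close> exceeds its quadratic model by at most \<open>L/6 \<parallel>s\<parallel>\<^sup>3\<close>, and the term
  \<open>\<sigma>/6 \<parallel>s\<parallel>\<^sup>3\<close> of the model decrease dominates this excess once \<open>\<sigma>\<close> is large.  Such an iteration is
  very successful, and \<open>\<sigma>\<close> is not increased.

  The function values decrease to a limit, so the gradients at successful iterations tend to zero.
  Unsuccessful iterations leave the iterate in place and multiply \<open>\<sigma>\<close> by a factor bounded away from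
  one; as \<open>\<sigma>\<close> is bounded, each iterate is also the iterate of some later successful iteration
  (\<open>run_next_successful\<close>), and the convergence extends to the whole sequence.
\<close>

section \<open>Second-order expansion with a cubic remainder\<close>

lemma has_derivative_gradient:
  fixes f :: "'a::euclidean_space \<Rightarrow> real"
  assumes "f differentiable (at x)"
  shows "(f has_derivative (\<lambda>h. h \<bullet> gradient f x)) (at x)"
proof -
  obtain f' where f': "(f has_derivative f') (at x)"
    using assms unfolding differentiable_def by blast
  interpret f': bounded_linear f'
    using f' by (rule has_derivative_bounded_linear)
  define D where "D = (\<Sum>b\<in>Basis. f' b *\<^sub>R b)"
  have "f' h = h \<bullet> D" for h
  proof -
    have "f' h = f' (\<Sum>b\<in>Basis. (h \<bullet> b) *\<^sub>R b)"
      by (simp add: euclidean_representation)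
    also have "\<dots> = h \<bullet> D"
      by (simp add: D_def f'.sum f'.scale inner_sum_right mult.commute)
    finally show ?thesis .
  qed
  then have "f' = (\<lambda>h. h \<bullet> D)"
    by blast
  with f' have D: "GDERIV f x :> D"
    by (simp add: gderiv_def)
  have "D' = D" if "GDERIV f x :> D'" for D'
  proof -
    have "(\<lambda>h. h \<bullet> D') = (\<lambda>h. h \<bullet> D)"
      using that D unfolding gderiv_def by (rule has_derivative_unique)
    then have "h \<bullet> D' = h \<bullet> D" for h
      by (simp only: fun_eq_iff)
    then show ?thesis
      using vector_eq_ldot[of D' D] by blast
  qed
  with D have "gradient f x = D"
    unfolding gradient_def by (rule the_equality)
  with D show ?thesis
    by (simp add: gderiv_def)
qed

lemma has_derivative_hessian:
  fixes f :: "real^'n \<Rightarrow> real"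
  assumes "gradient f differentiable (at x)"
  shows "(gradient f has_derivative (\<lambda>h. hessian f x *v h)) (at x)"
proof -
  have D: "(gradient f has_derivative frechet_derivative (gradient f) (at x)) (at x)"
    using assms by (simp add: frechet_derivative_works)
  then have "linear (frechet_derivative (gradient f) (at x))"
    by (rule has_derivative_linear)
  then have "(\<lambda>h. hessian f x *v h) = frechet_derivative (gradient f) (at x)"
    unfolding hessian_def by (auto simp: matrix_works)
  with D show ?thesis
    by simp
qed

lemma inner_matrix_vector_le_opnorm:
  fixes A :: "real^'n^'n"
  shows "v \<bullet> (A *v v) \<le> opnorm A * (norm v)\<^sup>2"
proof -
  have "v \<bullet> (A *v v) \<le> norm v * norm (A *v v)"
    by (rule norm_cauchy_schwarz)
  also have "\<dots> \<le> norm v * (opnorm A * norm v)"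
    by (intro mult_left_mono onorm) auto
  finally show ?thesis
    by (simp add: power2_eq_square algebra_simps)
qed

text \<open>
  Along a segment, the difference between the function and the right-hand side vanishes to first
  order at the start, and its second derivative is nonpositive, because there the Hessians differ
  in operator norm by at most the Lipschitz constant times the distance travelled.  Hence the
  difference is nonincreasing.
\<close>

lemma lipschitz_hessian_cubic_upper_bound:
  fixes f :: "real^'n \<Rightarrow> real"
  assumes f: "twice_differentiable f" and L: "lipschitz_hessian L f"
  shows "f (x + d) \<le> f x + gradient f x \<bullet> d + (1/2) * (d \<bullet> (hessian f x *v d)) + L / 6 * norm d ^ 3"
proof -
  define c where "c = d \<bullet> (hessian f x *v d)"
  define \<psi> where "\<psi> t = f (x + t *\<^sub>R d) - f x - t * (gradient f x \<bullet> d) - t\<^sup>2 / 2 * c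
      - L / 6 * t ^ 3 * norm d ^ 3" for t :: real
  define \<psi>' where "\<psi>' t = d \<bullet> gradient f (x + t *\<^sub>R d) - gradient f x \<bullet> d - t * c
      - L / 2 * t\<^sup>2 * norm d ^ 3" for t :: real
  define \<psi>'' where "\<psi>'' t = d \<bullet> (hessian f (x + t *\<^sub>R d) *v d) - c - L * t * norm d ^ 3" for t :: real
  have line: "((\<lambda>t. x + t *\<^sub>R d) has_derivative (\<lambda>h. h *\<^sub>R d)) (at t)" for t
    by (auto intro!: derivative_eq_intros)
  have "((\<lambda>t. f (x + t *\<^sub>R d)) has_derivative (\<lambda>h. (h *\<^sub>R d) \<bullet> gradient f (x + t *\<^sub>R d))) (at t)" for t
    using f by (intro has_derivative_compose[OF line] has_derivative_gradient)
      (simp add: twice_differentiable_def)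
  then have df: "((\<lambda>t. f (x + t *\<^sub>R d)) has_real_derivative d \<bullet> gradient f (x + t *\<^sub>R d)) (at t)" for t
    by (simp add: has_field_derivative_def mult_commute_abs)
  have "((\<lambda>t. gradient f (x + t *\<^sub>R d)) has_derivative
      (\<lambda>h. hessian f (x + t *\<^sub>R d) *v (h *\<^sub>R d))) (at t)" for t
    using f by (intro has_derivative_compose[OF line] has_derivative_hessian)
      (simp add: twice_differentiable_def)
  then have "((\<lambda>t. d \<bullet> gradient f (x + t *\<^sub>R d)) has_derivative
      (\<lambda>h. d \<bullet> (hessian f (x + t *\<^sub>R d) *v (h *\<^sub>R d)))) (at t)" for t
    by (rule has_derivative_inner_right)
  then have ddf: "((\<lambda>t. d \<bullet> gradient f (x + t *\<^sub>R d)) has_real_derivative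
      d \<bullet> (hessian f (x + t *\<^sub>R d) *v d)) (at t)" for t
    by (simp add: has_field_derivative_def matrix_vector_mult_scaleR mult_commute_abs)
  have \<psi>: "(\<psi> has_real_derivative \<psi>' t) (at t)" for t
    unfolding \<psi>_def[abs_def] \<psi>'_def
    by (auto intro!: derivative_eq_intros df simp: field_simps power2_eq_square)
  have \<psi>': "(\<psi>' has_real_derivative \<psi>'' t) (at t)" for t
    unfolding \<psi>'_def[abs_def] \<psi>''_def
    by (auto intro!: derivative_eq_intros ddf simp: field_simps)
  have \<psi>''_nonpos: "\<psi>'' t \<le> 0" if "0 \<le> t" for t
  proof -
    have "opnorm (hessian f (x + t *\<^sub>R d) - hessian f x) \<le> L * (t * norm d)"
      using L that unfolding lipschitz_hessian_def by (metis abs_of_nonneg add_diff_cancel_left' norm_scaleR)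
    moreover have "d \<bullet> (hessian f (x + t *\<^sub>R d) *v d) - c
        \<le> opnorm (hessian f (x + t *\<^sub>R d) - hessian f x) * (norm d)\<^sup>2"
      using inner_matrix_vector_le_opnorm[of d "hessian f (x + t *\<^sub>R d) - hessian f x"]
      by (simp add: c_def matrix_vector_mult_diff_rdistrib inner_diff_right)
    ultimately have "d \<bullet> (hessian f (x + t *\<^sub>R d) *v d) - c \<le> L * (t * norm d) * (norm d)\<^sup>2"
      by (meson mult_right_mono order_trans zero_le_power2)
    then show ?thesis
      by (simp add: \<psi>''_def power2_eq_square power3_eq_cube mult.assoc)
  qed
  have "\<psi>' t \<le> 0" if "0 \<le> t" for t
  proof -
    have "\<psi>' t \<le> \<psi>' 0"
      by (rule DERIV_nonpos_imp_nonincreasing[OF that]) (use \<psi>' \<psi>''_nonpos in blast)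
    then show ?thesis
      by (simp add: \<psi>'_def inner_commute)
  qed
  then have "\<psi> 1 \<le> \<psi> 0"
    using DERIV_nonpos_imp_nonincreasing[of 0 1 \<psi>] \<psi> zero_le_one by blast
  then have "f (x + d) - f x - 1 * (gradient f x \<bullet> d) - 1\<^sup>2 / 2 * c
      - L / 6 * 1 ^ 3 * norm d ^ 3 \<le> 0"
    unfolding \<psi>_def[abs_def] by simp
  then show ?thesis
    unfolding c_def by simp
qed

section \<open>Blocks\<close>

lemma block_embed_mult_nth: "(block_embed I *v v) $ i = (if i \<in> I then v $ i else 0)"
proof -
  have "(if i = j \<and> j \<in> I then 1 else 0) * v $ j
      = (if i = j then (if i \<in> I then v $ i else 0) else 0)" for j
    by simp
  then have "(block_embed I *v v) $ i = (\<Sum>j\<in>UNIV. if i = j then (if i \<in> I then v $ i else 0) else 0)"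
    by (simp only: block_embed_def matrix_vector_mult_def vec_lambda_beta)
  then show ?thesis
    by simp
qed

lemma transpose_block_embed [simp]: "transpose (block_embed I) = block_embed I"
  by (auto simp: block_embed_def transpose_def vec_eq_iff)

lemma block_embed_block_space: "v \<in> block_space I \<Longrightarrow> block_embed I *v v = v"
  by (auto simp: block_space_def vec_eq_iff block_embed_mult_nth)

lemma norm_block_embed_le: "norm (block_embed I *v v) \<le> norm v"
  by (rule norm_le_componentwise_cart) (simp add: block_embed_mult_nth)

lemma opnorm_block_hessian_le: "opnorm (block_hessian I f x) \<le> opnorm (hessian f x)"
proof (rule onorm_le)
  fix v
  have "norm (block_hessian I f x *v v) \<le> norm (hessian f x *v (block_embed I *v v))"
    by (simp add: block_hessian_def norm_block_embed_le flip: matrix_vector_mul_assoc)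
  also have "\<dots> \<le> opnorm (hessian f x) * norm (block_embed I *v v)"
    by (intro onorm) auto
  also have "\<dots> \<le> opnorm (hessian f x) * norm v"
    by (intro mult_left_mono norm_block_embed_le onorm_pos_le) auto
  finally show "norm (block_hessian I f x *v v) \<le> opnorm (hessian f x) * norm v" .
qed

lemma quad_model_zero [simp]: "quad_model I f x 0 = f x"
  by (simp add: quad_model_def)

lemma quad_model_block_space:
  fixes f :: "real^'n \<Rightarrow> real"
  assumes "v \<in> block_space I"
  shows "quad_model I f x v = f x + gradient f x \<bullet> v + (1/2) * (v \<bullet> (hessian f x *v v))"
proof -
  have adj: "u \<bullet> (block_embed I *v w) = (block_embed I *v u) \<bullet> w" for u w :: "real^'n"
    by (metis dot_lmul_matrix transpose_block_embed vector_transpose_matrix)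
  show ?thesis
    using assms
    by (simp add: quad_model_def block_gradient_def block_hessian_def adj block_embed_block_space
        flip: matrix_vector_mul_assoc adj[of "gradient f x"])
qed

section \<open>Decrease of the model\<close>

lemma cauchy_stepsize_bounds:
  assumes "0 < \<beta>" "0 < \<sigma>" "block_gradient I f x \<noteq> 0"
  defines "\<alpha> \<equiv> cauchy_stepsize \<beta> I f x \<sigma>"
  shows "0 < \<alpha>" "\<alpha> * opnorm (block_hessian I f x) \<le> \<beta>"
    "\<sigma> * \<alpha>\<^sup>2 * norm (block_gradient I f x) \<le> 3 * \<beta>"
proof -
  define h where "h = opnorm (block_hessian I f x)"
  define r where "r = sqrt (3 * \<beta> / (\<sigma> * norm (block_gradient I f x)))"
  have h: "0 \<le> h"
    unfolding h_def by (intro onorm_pos_le) auto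
  have r: "0 < r"
    using assms(1-3) by (simp add: r_def)
  have \<alpha>: "\<alpha> = (if h = 0 then r else min (\<beta> / h) r)"
    by (simp add: \<alpha>_def cauchy_stepsize_def h_def r_def Let_def)
  show pos: "0 < \<alpha>"
    unfolding \<alpha> using h r assms(1) by simp
  show "\<alpha> * opnorm (block_hessian I f x) \<le> \<beta>"
    unfolding h_def[symmetric] \<alpha> using h assms(1) by (auto simp: min_def field_simps)
  have "\<alpha> \<le> r"
    unfolding \<alpha> by simp
  with pos have "\<alpha>\<^sup>2 \<le> r\<^sup>2"
    by (intro power_mono) auto
  also have "r\<^sup>2 = 3 * \<beta> / (\<sigma> * norm (block_gradient I f x))"
    using assms(1-3) by (simp add: r_def)
  finally show "\<sigma> * \<alpha>\<^sup>2 * norm (block_gradient I f x) \<le> 3 * \<beta>"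
    using assms(1-3) by (simp add: field_simps)
qed

text \<open>
  The two caps on the step size limit the curvature term and the cubic term to \<open>\<beta>/2\<close> of the
  first-order decrease each.
\<close>

lemma cauchy_step_decrease:
  assumes "0 < \<beta>" "0 < \<sigma>" "block_gradient I f x \<noteq> 0"
  shows "cubic_model I f x \<sigma> (cauchy_step \<beta> I f x \<sigma>)
    \<le> f x - (1 - \<beta>) * cauchy_stepsize \<beta> I f x \<sigma> * (norm (block_gradient I f x))\<^sup>2"
proof -
  define g where "g = block_gradient I f x"
  define H where "H = block_hessian I f x"
  define \<alpha> where "\<alpha> = cauchy_stepsize \<beta> I f x \<sigma>"
  have \<alpha>: "0 < \<alpha>" "\<alpha> * opnorm H \<le> \<beta>" "\<sigma> * \<alpha>\<^sup>2 * norm g \<le> 3 * \<beta>"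
    using cauchy_stepsize_bounds[OF assms] by (simp_all add: \<alpha>_def g_def H_def)
  have "\<alpha>\<^sup>2 * (g \<bullet> (H *v g)) \<le> \<alpha>\<^sup>2 * (opnorm H * (norm g)\<^sup>2)"
    by (intro mult_left_mono inner_matrix_vector_le_opnorm) auto
  also have "\<dots> = \<alpha> * (norm g)\<^sup>2 * (\<alpha> * opnorm H)"
    by (simp add: power2_eq_square)
  also have "\<dots> \<le> \<alpha> * (norm g)\<^sup>2 * \<beta>"
    using \<alpha> by (intro mult_left_mono) auto
  finally have quad: "\<alpha>\<^sup>2 * (g \<bullet> (H *v g)) \<le> \<alpha> * (norm g)\<^sup>2 * \<beta>" .
  have "\<sigma> * (\<alpha> * norm g) ^ 3 = \<alpha> * (norm g)\<^sup>2 * (\<sigma> * \<alpha>\<^sup>2 * norm g)"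
    by (simp add: power2_eq_square power3_eq_cube)
  also have "\<dots> \<le> \<alpha> * (norm g)\<^sup>2 * (3 * \<beta>)"
    using \<alpha> by (intro mult_left_mono) auto
  finally have cub: "\<sigma> * (\<alpha> * norm g) ^ 3 \<le> \<alpha> * (norm g)\<^sup>2 * (3 * \<beta>)" .
  have "cubic_model I f x \<sigma> (cauchy_step \<beta> I f x \<sigma>)
      = f x - \<alpha> * (norm g)\<^sup>2 + \<alpha>\<^sup>2 * (g \<bullet> (H *v g)) / 2 + \<sigma> * (\<alpha> * norm g) ^ 3 / 6"
    using \<alpha>(1)
    by (simp add: cubic_model_def quad_model_def cauchy_step_def matrix_vector_mult_scaleR
        dot_square_norm power2_eq_square
        flip: g_def H_def \<alpha>_def scaleR_minus_left)
  also have "\<dots> \<le> f x - (1 - \<beta>) * \<alpha> * (norm g)\<^sup>2"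
    using quad cub by (simp add: algebra_simps)
  finally show ?thesis
    by (simp add: g_def \<alpha>_def)
qed

text \<open>
  The decrease of the cubic model is inherited from the Cauchy step, and the quadratic model lies
  below the cubic one by exactly the regularization term.
\<close>

lemma quad_model_decrease:
  assumes "valid_parameters p" "step_choice p f x \<sigma> I s" "0 < \<sigma>" "block_gradient I f x \<noteq> 0"
  shows "(1 - beta p) * cauchy_stepsize (beta p) I f x \<sigma> * (norm (block_gradient I f x))\<^sup>2
      + \<sigma> / 6 * norm s ^ 3 \<le> f x - quad_model I f x s"
proof -
  have "cubic_model I f x \<sigma> s \<le> f x
      - (1 - beta p) * cauchy_stepsize (beta p) I f x \<sigma> * (norm (block_gradient I f x))\<^sup>2"
    using cauchy_step_decrease[of "beta p" \<sigma> I f x] assms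
    by (auto simp: step_choice_def valid_parameters_def)
  then show ?thesis
    by (simp add: cubic_model_def)
qed

lemma quad_model_decrease_pos:
  assumes "valid_parameters p" "step_choice p f x \<sigma> I s" "0 < \<sigma>" "block_gradient I f x \<noteq> 0"
  shows "0 < f x - quad_model I f x s"
proof -
  have "0 < (1 - beta p) * cauchy_stepsize (beta p) I f x \<sigma> * (norm (block_gradient I f x))\<^sup>2"
    using assms cauchy_stepsize_bounds(1)[of "beta p" \<sigma> I f x] by (simp add: valid_parameters_def)
  moreover have "0 \<le> \<sigma> / 6 * norm s ^ 3"
    using assms by simp
  ultimately show ?thesis
    using quad_model_decrease[OF assms] by linarith
qed

text \<open>
  When \<open>\<sigma> \<ge> L / (1 - \<eta>\<^sub>2)\<close>, the cubic remainder is at most a fraction \<open>1 - \<eta>\<^sub>2\<close> of the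
  regularization term, hence of the decrease of the quadratic model, so the remaining fraction
  \<open>\<eta>\<^sub>2\<close> of that decrease is realized by the function.
\<close>

lemma very_successful_if_sigma_large:
  fixes f :: "real^'n \<Rightarrow> real"
  assumes f: "twice_differentiable f" "lipschitz_hessian L f"
    and p: "valid_parameters p" and s: "step_choice p f x \<sigma> I s"
    and \<sigma>: "0 < \<sigma>" "L / (1 - eta2 p) \<le> \<sigma>" and g: "block_gradient I f x \<noteq> 0"
  shows "eta2 p \<le> decrease_ratio I f x s"
proof -
  define P where "P = f x - quad_model I f x s"
  have sI: "s \<in> block_space I"
    using s by (simp add: step_choice_def)
  have P: "0 < P"
    unfolding P_def using quad_model_decrease_pos p s \<sigma>(1) g .
  have \<eta>: "0 < 1 - eta2 p"
    using p by (simp add: valid_parameters_def)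
  have "0 \<le> (1 - beta p) * cauchy_stepsize (beta p) I f x \<sigma> * (norm (block_gradient I f x))\<^sup>2"
    using p \<sigma>(1) g cauchy_stepsize_bounds(1)[of "beta p" \<sigma> I f x]
    by (intro mult_nonneg_nonneg) (auto simp: valid_parameters_def)
  then have cube: "\<sigma> / 6 * norm s ^ 3 \<le> P"
    using quad_model_decrease[OF p s \<sigma>(1) g] by (simp add: P_def)
  have "L / 6 * norm s ^ 3 \<le> ((1 - eta2 p) * \<sigma>) / 6 * norm s ^ 3"
    using \<sigma>(2) \<eta> by (intro mult_right_mono divide_right_mono) (auto simp: field_simps)
  also have "\<dots> \<le> (1 - eta2 p) * P"
    using mult_left_mono[OF cube, of "1 - eta2 p"] \<eta> by simp
  finally have "f (x + s) \<le> quad_model I f x s + (1 - eta2 p) * P"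
    using lipschitz_hessian_cubic_upper_bound[OF f, of x s] quad_model_block_space[OF sI, of f x]
    by simp
  then have "eta2 p * P \<le> f x - f (x + s)"
    by (simp add: P_def algebra_simps)
  then show ?thesis
    using P sI by (simp add: decrease_ratio_def block_embed_block_space P_def pos_le_divide_eq)
qed

section \<open>Runs of the method\<close>

context
  fixes p :: ibcn_parameters and f :: "real^'n \<Rightarrow> real"
    and x s :: "nat \<Rightarrow> real^'n" and \<sigma> :: "nat \<Rightarrow> real" and I :: "nat \<Rightarrow> 'n set"
  assumes p: "valid_parameters p" and run: "infinite_ibcn_run p f x \<sigma> I s"
begin

definition successful :: "nat \<Rightarrow> bool" where
  "successful k \<longleftrightarrow> eta1 p \<le> decrease_ratio (I k) f (x k) (s k)"

lemma run_iteration: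
  shows run_gradient_nonzero: "gradient f (x k) \<noteq> 0"
    and run_block_choice: "block_choice p f (x k) (I k)"
    and run_step_choice: "step_choice p f (x k) (\<sigma> k) (I k) (s k)"
    and run_next_iterate: "x (Suc k) = (if successful k then x k + block_embed (I k) *v s k else x k)"
    and run_sigma_update: "\<sigma> (Suc k) \<in> sigma_update p (decrease_ratio (I k) f (x k) (s k)) (\<sigma> k)"
  using run unfolding infinite_ibcn_run_def Let_def successful_def by blast+

lemma run_step_in_block: "s k \<in> block_space (I k)"
  using run_step_choice[of k] by (simp add: step_choice_def)

lemma run_unsuccessful: "\<not> successful k \<Longrightarrow> x (Suc k) = x k"
  by (simp add: run_next_iterate)

lemma run_successful: "successful k \<Longrightarrow> x (Suc k) = x k + s k"
  by (simp add: run_next_iterate block_embed_block_space run_step_in_block)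

lemma run_block_gradient: "theta p * norm (gradient f (x k)) \<le> norm (block_gradient (I k) f (x k))"
  using run_block_choice[of k] by (simp add: block_choice_def)

lemma run_block_gradient_nonzero: "block_gradient (I k) f (x k) \<noteq> 0"
proof -
  have "0 < theta p * norm (gradient f (x k))"
    using p run_gradient_nonzero[of k] by (simp add: valid_parameters_def)
  with run_block_gradient[of k] show ?thesis
    by auto
qed

lemma run_sigma_min: "sigma_min p \<le> \<sigma> k"
proof (induction k)
  case 0
  show ?case
    using run unfolding infinite_ibcn_run_def by blast
next
  case (Suc k)
  have "\<sigma> k \<le> gamma2 p * \<sigma> k"
    using Suc p by (simp add: valid_parameters_def)
  with Suc run_sigma_update[of k] show ?case
    by (auto simp: sigma_update_def split: if_splits)
qed

lemma run_sigma_pos: "0 < \<sigma> k"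
  using run_sigma_min[of k] p by (simp add: valid_parameters_def)

text \<open>
  The regularization parameter only grows while it is below \<open>L / (1 - \<eta>\<^sub>2)\<close>, and then by a factor of
  at most \<open>\<gamma>\<^sub>3\<close>.
\<close>

lemma run_sigma_bounded:
  assumes "twice_differentiable f" "lipschitz_hessian L f"
  shows "\<sigma> k \<le> max (\<sigma> 0) (gamma3 p * (L / (1 - eta2 p)))"
proof (induction k)
  case (Suc k)
  have \<gamma>: "1 < gamma2 p" "gamma2 p \<le> gamma3 p"
    using p by (auto simp: valid_parameters_def)
  show ?case
  proof (cases "eta2 p \<le> decrease_ratio (I k) f (x k) (s k)")
    case True
    with Suc run_sigma_update[of k] show ?thesis
      by (simp add: sigma_update_def)
  next
    case False
    then have "\<sigma> k < L / (1 - eta2 p)"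
      using very_successful_if_sigma_large[OF assms p run_step_choice run_sigma_pos _
          run_block_gradient_nonzero] by force
    then have "gamma3 p * \<sigma> k \<le> gamma3 p * (L / (1 - eta2 p))"
      using \<gamma> by (intro mult_left_mono) auto
    moreover have "gamma2 p * \<sigma> k \<le> gamma3 p * \<sigma> k"
      using \<gamma> run_sigma_pos[of k] by simp
    ultimately show ?thesis
      using run_sigma_update[of k] False by (auto simp: sigma_update_def split: if_splits)
  qed
qed simp

text \<open>
  An unsuccessful iteration keeps the iterate and multiplies the regularization parameter by at
  least \<open>\<gamma>\<^sub>2 > 1\<close>, so a bound on that parameter excludes an unbroken sequence of failures.
\<close>

lemma run_next_successful:
  assumes bound: "\<And>k. \<sigma> k \<le> S"
  obtains j where "k \<le> j" "successful j" "x j = x k"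
proof (rule ccontr)
  assume "\<not> thesis"
  with that have none: "\<not> successful j" if "k \<le> j" "x j = x k" for j
    using \<open>k \<le> j\<close> \<open>x j = x k\<close> by blast
  have \<gamma>: "1 < gamma2 p" "eta1 p \<le> eta2 p"
    using p by (auto simp: valid_parameters_def)
  have grow: "x (k + n) = x k \<and> gamma2 p ^ n * \<sigma> k \<le> \<sigma> (k + n)" for n
  proof (induction n)
    case (Suc n)
    then have fail: "\<not> successful (k + n)"
      using none by simp
    then have "gamma2 p * \<sigma> (k + n) \<le> \<sigma> (Suc (k + n))"
      using run_sigma_update[of "k + n"] \<gamma>
      by (auto simp: sigma_update_def successful_def split: if_splits)
    moreover have "gamma2 p * (gamma2 p ^ n * \<sigma> k) \<le> gamma2 p * \<sigma> (k + n)"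
      using Suc \<gamma> by (intro mult_left_mono) auto
    ultimately show ?case
      using Suc run_unsuccessful[OF fail] by (simp add: mult.assoc)
  qed simp
  obtain n where "S / \<sigma> k < gamma2 p ^ n"
    using real_arch_pow[OF \<gamma>(1)] by blast
  then have "S < gamma2 p ^ n * \<sigma> k"
    using run_sigma_pos[of k] by (simp add: pos_divide_less_eq)
  with grow[of n] bound[of "k + n"] show False
    by linarith
qed

lemma run_successful_decrease:
  assumes "successful k"
  shows "eta1 p * ((1 - beta p) * cauchy_stepsize (beta p) (I k) f (x k) (\<sigma> k)
      * (norm (block_gradient (I k) f (x k)))\<^sup>2) \<le> f (x k) - f (x (Suc k))"
proof -
  define P where "P = f (x k) - quad_model (I k) f (x k) (s k)"
  have \<eta>: "0 < eta1 p"
    using p by (simp add: valid_parameters_def)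
  have P: "0 < P"
    unfolding P_def
    using quad_model_decrease_pos p run_step_choice run_sigma_pos run_block_gradient_nonzero .
  have "0 \<le> \<sigma> k / 6 * norm (s k) ^ 3"
    using run_sigma_pos[of k] by simp
  then have "(1 - beta p) * cauchy_stepsize (beta p) (I k) f (x k) (\<sigma> k)
      * (norm (block_gradient (I k) f (x k)))\<^sup>2 \<le> P"
    using quad_model_decrease[OF p run_step_choice[of k] run_sigma_pos run_block_gradient_nonzero]
    unfolding P_def by linarith
  then have "eta1 p * ((1 - beta p) * cauchy_stepsize (beta p) (I k) f (x k) (\<sigma> k)
      * (norm (block_gradient (I k) f (x k)))\<^sup>2) \<le> eta1 p * P"
    using \<eta> by (intro mult_left_mono) auto
  also have "eta1 p * P \<le> f (x k) - f (x (Suc k))"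
    using assms P run_successful[OF assms]
    by (simp add: successful_def decrease_ratio_def P_def pos_le_divide_eq block_embed_block_space
        run_step_in_block)
  finally show ?thesis .
qed

lemma run_decreasing: "decseq (\<lambda>k. f (x k))"
proof (rule decseq_SucI)
  fix k
  show "f (x (Suc k)) \<le> f (x k)"
  proof (cases "successful k")
    case True
    have "0 \<le> eta1 p * ((1 - beta p) * cauchy_stepsize (beta p) (I k) f (x k) (\<sigma> k)
        * (norm (block_gradient (I k) f (x k)))\<^sup>2)"
      using p cauchy_stepsize_bounds(1)[of "beta p" "\<sigma> k" "I k" f "x k"] run_sigma_pos
        run_block_gradient_nonzero
      by (intro mult_nonneg_nonneg) (auto simp: valid_parameters_def intro: less_imp_le)
    then show ?thesis
      using run_successful_decrease[OF True] by linarith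
  next
    case False
    then show ?thesis
      by (simp add: run_unsuccessful)
  qed
qed

text \<open>
  The two arguments of the minimum defining the Cauchy step size are bounded below separately.  The
  second one decreases in the norm of the block gradient, but its product with the squared norm
  increases, since it is proportional to the power \<open>3/2\<close> of the norm.
\<close>

lemma run_cauchy_decrease_lower_bound:
  assumes S: "\<sigma> k \<le> S" and B: "opnorm (hessian f (x k)) \<le> B" "0 < B"
    and \<epsilon>: "0 < \<epsilon>" "\<epsilon> \<le> norm (block_gradient (I k) f (x k))"
  shows "min (beta p / B * \<epsilon>\<^sup>2) (sqrt (3 * beta p * \<epsilon> ^ 3 / S))
    \<le> cauchy_stepsize (beta p) (I k) f (x k) (\<sigma> k) * (norm (block_gradient (I k) f (x k)))\<^sup>2"
proof -
  define g where "g = norm (block_gradient (I k) f (x k))"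
  define h where "h = opnorm (block_hessian (I k) f (x k))"
  define r where "r = sqrt (3 * beta p / (\<sigma> k * g))"
  have h: "0 \<le> h" "h \<le> B"
    unfolding h_def using opnorm_block_hessian_le[of "I k" f "x k"] B
    by (auto intro: onorm_pos_le)
  have \<beta>: "0 < beta p"
    using p by (simp add: valid_parameters_def)
  have g: "0 < g" "\<epsilon> \<le> g"
    using \<epsilon> by (auto simp: g_def)
  have \<sigma>: "0 < \<sigma> k" "0 < S"
    using run_sigma_pos[of k] S by auto
  have "r * g\<^sup>2 = sqrt (3 * beta p / (\<sigma> k * g) * g ^ 4)"
    unfolding r_def real_sqrt_mult using g
    by (metis numeral_Bit0_eq_double power2_eq_square power_even_eq real_sqrt_abs abs_of_nonneg zero_le_power2)
  also have "3 * beta p / (\<sigma> k * g) * g ^ 4 = 3 * beta p * g ^ 3 / \<sigma> k"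
    using g \<sigma> by (simp add: field_simps eval_nat_numeral)
  finally have "r * g\<^sup>2 = sqrt (3 * beta p * g ^ 3 / \<sigma> k)" .
  moreover have "3 * beta p * \<epsilon> ^ 3 / S \<le> 3 * beta p * g ^ 3 / \<sigma> k"
    using g \<sigma> \<beta> \<epsilon> S by (intro frac_le mult_left_mono power_mono) auto
  ultimately have radius: "sqrt (3 * beta p * \<epsilon> ^ 3 / S) \<le> r * g\<^sup>2"
    by simp
  have curvature: "beta p / B * \<epsilon>\<^sup>2 \<le> beta p / h * g\<^sup>2" if "h \<noteq> 0"
    using that h B g \<beta> \<epsilon> by (intro mult_mono power_mono frac_le) auto
  have "cauchy_stepsize (beta p) (I k) f (x k) (\<sigma> k) = (if h = 0 then r else min (beta p / h) r)"
    by (simp add: cauchy_stepsize_def h_def r_def g_def Let_def)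
  then show ?thesis
    using radius curvature unfolding g_def[symmetric] by (auto simp: min_def)
qed

end

theorem theorem12:
  fixes f :: "real^'n \<Rightarrow> real" and L :: real
    and p :: ibcn_parameters
    and x :: "nat \<Rightarrow> real^'n" and \<sigma> :: "nat \<Rightarrow> real"
    and I :: "nat \<Rightarrow> 'n set" and s :: "nat \<Rightarrow> real^'n"
  assumes "L > 0"
    and "twice_differentiable f"
    and "lipschitz_hessian L f"
    and "valid_parameters p"
    and "infinite_ibcn_run p f x \<sigma> I s"
    and "\<exists>f_min B. \<forall>y. f y \<le> f (x 0) \<longrightarrow> f_min \<le> f y \<and> opnorm (hessian f y) \<le> B"
  shows "(\<lambda>k. gradient f (x k)) \<longlonglongrightarrow> 0"
proof (rule LIMSEQ_I)
  note p = assms(4) and run = assms(5)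
  obtain f_min B where level: "\<And>y. f y \<le> f (x 0) \<Longrightarrow> f_min \<le> f y \<and> opnorm (hessian f y) \<le> B"
    using assms(6) by blast
  have decr: "decseq (\<lambda>k. f (x k))"
    using run_decreasing[OF p run] .
  have in_level: "f (x k) \<le> f (x 0)" for k
    using decr by (simp add: decseq_def)
  obtain l where "(\<lambda>k. f (x k)) \<longlonglongrightarrow> l"
    using decseq_convergent[OF decr, of f_min] level[OF in_level] by blast
  then have vanish: "(\<lambda>k. f (x k) - f (x (Suc k))) \<longlonglongrightarrow> 0"
    using tendsto_diff[OF _ LIMSEQ_Suc] by fastforce
  define S where "S = max (\<sigma> 0) (gamma3 p * (L / (1 - eta2 p)))"
  have S: "\<sigma> k \<le> S" for k
    unfolding S_def using run_sigma_bounded[OF p run assms(2,3)] .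
  have S_pos: "0 < S"
    using run_sigma_pos[OF p run, of 0] S[of 0] by linarith
  fix \<epsilon> :: real
  assume \<epsilon>: "0 < \<epsilon>"
  (* the bound on the Hessian may be zero, and the step size estimate divides by it *)
  define \<delta> where "\<delta> = eta1 p * ((1 - beta p) *
      min (beta p / max B 1 * (theta p * \<epsilon>)\<^sup>2) (sqrt (3 * beta p * (theta p * \<epsilon>) ^ 3 / S)))"
  have "0 < \<delta>"
    using p \<epsilon> S_pos by (auto simp: \<delta>_def valid_parameters_def intro!: mult_pos_pos)
  then obtain N where N: "\<And>k. N \<le> k \<Longrightarrow> \<bar>f (x k) - f (x (Suc k))\<bar> < \<delta>"
    using LIMSEQ_D[OF vanish] by auto
  have successful_small: "norm (gradient f (x j)) < \<epsilon>"
    if j: "N \<le> j" "successful p f x s I j" for j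
  proof (rule ccontr)
    assume "\<not> norm (gradient f (x j)) < \<epsilon>"
    then have "theta p * \<epsilon> \<le> theta p * norm (gradient f (x j))"
      using p by (simp add: valid_parameters_def)
    also have "\<dots> \<le> norm (block_gradient (I j) f (x j))"
      using run_block_gradient[OF p run] .
    finally have "min (beta p / max B 1 * (theta p * \<epsilon>)\<^sup>2) (sqrt (3 * beta p * (theta p * \<epsilon>) ^ 3 / S))
        \<le> cauchy_stepsize (beta p) (I j) f (x j) (\<sigma> j) * (norm (block_gradient (I j) f (x j)))\<^sup>2"
      using p \<epsilon> S level[OF in_level[of j]]
      by (intro run_cauchy_decrease_lower_bound[OF p run]) (auto simp: valid_parameters_def)
    then have "\<delta> \<le> eta1 p * ((1 - beta p) * (cauchy_stepsize (beta p) (I j) f (x j) (\<sigma> j)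
        * (norm (block_gradient (I j) f (x j)))\<^sup>2))"
      unfolding \<delta>_def using p by (intro mult_left_mono) (auto simp: valid_parameters_def)
    then show False
      using run_successful_decrease[OF p run j(2)] N[OF j(1)] by (simp add: mult.assoc)
  qed
  have "norm (gradient f (x k) - 0) < \<epsilon>" if "N \<le> k" for k
  proof -
    obtain j where "k \<le> j" "successful p f x s I j" "x j = x k"
      using run_next_successful[OF p run S] .
    then show ?thesis
      using successful_small[of j] that by simp
  qed
  then show "\<exists>N. \<forall>k\<ge>N. norm (gradient f (x k) - 0) < \<epsilon>"
    by blast
qed

end
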